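(* Let $f:\mathbb{R}^n\to\mathbb{R}$ be continuously differentiable and convex, let $P\subset\mathbb{R}^n$ be a nonempty compact convex set, and let $x^*\in P$ be a minimizer of $f$ over $P$. Fix the number of outer iterations $N\ge1$. Let $\{x_k\},\{y_k\},\{z_k\}$ be generated by AdCGS (defined in the context), with local Lipschitz estimates $L_k$ as defined in the context and with the following parameters: $\delta_k=\frac{D_0^2}{Nk}$, where $D_0:=\|z_0-x^*\|$; $\tau_1=0$ and $\tau_k=k/2$ for $k\ge2$; $\beta_1=0$ and $\beta_k=\beta$ for $k\ge2$, where $\beta\in(0,1-\sqrt6/3]$; $\eta_1>0$ and $$\eta_k=\begin{cases}\min\{(1-\beta)\eta_1,\frac{1}{4L_1}\},&k=2,\\ \min\{\eta_2,\frac1{4L_2}\},&k=3,\\ \min\left\{\frac{k}{k-1}\eta_{k-1},\frac{k-1}{8L_{k-1}}\right\},&k\ge4.\end{cases}$$ Then $$f(x_N)-f(x^* )\le\frac{12\hat L_N}{N(N+1)}\left(2E+\frac{3(1-\beta)\eta_1D_0^2}{2}\right),$$ where $\hat L_N:=\max\left\{\frac{1}{4(1-\beta)\eta_1},\max_{1\le i\le N}L_i\right\}$ and $$E:=\frac{1}{2\beta}\|z_0-x^*\|^2+\frac{\eta_2}{2}\left(\frac{5L_1}{2}-\frac1{\eta_1}\right)\|z_1-z_0\|^2.$$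
   Context: $\|\cdot\|$ and $\langle\cdot,\cdot\rangle$ are the Euclidean norm and inner product. $D_f(x,y):=f(x)-f(y)-\langle\nabla f(y),x-y\rangle$. Conventions: $\frac00=0$ and $\frac a0=+\infty$ for $a>0$. Procedure $\mathrm{CG}(g,u,\eta,\delta)$: set $u_1=u$. For $t=1,2,\ldots$: choose $v_t\in\operatorname{argmin}_{v\in P}\langle g+(u_t-u)/\eta,v\rangle$; if $\max_{v\in P}\langle g+(u_t-u)/\eta,u_t-v\rangle\le\delta$, return $u_t$; otherwise set $\gamma_t=\min\bigl\{1,\frac{\langle g+(u_t-u)/\eta,u_t-v_t\rangle}{\|v_t-u_t\|^2/\eta}\bigr\}$ and $u_{t+1}=(1-\gamma_t)u_t+\gamma_tv_t$. AdCGS: given $x_0=y_0=z_0\in P$ and parameters $\beta_k\in[0,1]$, $\delta_k>0$, $\eta_k>0$, $\tau_k\ge0$, for $k=1,2,\ldots$: $z_k=\mathrm{CG}(\nabla f(x_{k-1}),y_{k-1},\eta_k,\delta_k)$, $y_k=(1-\beta_k)y_{k-1}+\beta_kz_k$, $x_k=\frac{\tau_k}{1+\tau_k}x_{k-1}+\frac{1}{1+\tau_k}z_k$; then $L_k$ is computed and $\eta_{k+1}$ is set by the stepsize rule. It is assumed that $x_1\ne x_0$. Local Lipschitz estimates: $L_1=\frac{\|\nabla f(x_1)-\nabla f(x_0)\|}{\|x_1-x_0\|}$ and, for $k\ge2$, $L_k=0$ if $D_f(x_{k-1},x_k)=0$ and $L_k=\frac{\|\nabla f(x_k)-\nabla f(x_{k-1})\|^2}{2D_f(x_{k-1},x_k)}$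 if $D_f(x_{k-1},x_k)>0$. *)

theory Defs
  imports "HOL-Analysis.Analysis"
begin

unbundle inner_syntax

text \<open>Throughout, \<open>g :: 'a \<Rightarrow> 'a\<close> in the last three definitions stands for the gradient map of \<open>f\<close>;
  the theorem that uses them assumes \<open>GDERIV f x :> g x\<close> for all \<open>x\<close>.\<close>

text \<open>The conditional gradient procedure, as a relation since the choice of the linear minimizer
  is not unique: \<open>cg P g u \<eta> \<delta> w w'\<close> says that the loop, when its current iterate is \<open>w\<close>,
  may return \<open>w'\<close> after finitely many steps. A call of the procedure starts from \<open>w = u\<close>.
  The supremum is a maximum when \<open>P\<close> is nonempty and compact. In \<open>step\<close> the gap is larger than
  \<open>\<delta>\<close>, so for \<open>\<delta> \<ge> 0\<close> one has \<open>v \<noteq> w\<close> and the quotient defining \<open>\<gamma>\<close> is a genuine one.\<close>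

inductive cg :: "'a::real_inner set \<Rightarrow> 'a \<Rightarrow> 'a \<Rightarrow> real \<Rightarrow> real \<Rightarrow> 'a \<Rightarrow> 'a \<Rightarrow> bool"
  for P g u \<eta> \<delta> where
  return: "(SUP v\<in>P. (g + (1 / \<eta>) *\<^sub>R (w - u)) \<bullet> (w - v)) \<le> \<delta> \<Longrightarrow> cg P g u \<eta> \<delta> w w"
| step: "is_arg_min (\<lambda>v. (g + (1 / \<eta>) *\<^sub>R (w - u)) \<bullet> v) (\<lambda>v. v \<in> P) v
    \<Longrightarrow> \<not> (SUP v\<in>P. (g + (1 / \<eta>) *\<^sub>R (w - u)) \<bullet> (w - v)) \<le> \<delta>
    \<Longrightarrow> \<gamma> = min 1 (((g + (1 / \<eta>) *\<^sub>R (w - u)) \<bullet> (w - v)) / ((norm (v - w))\<^sup>2 / \<eta>))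
    \<Longrightarrow> cg P g u \<eta> \<delta> ((1 - \<gamma>) *\<^sub>R w + \<gamma> *\<^sub>R v) w'
    \<Longrightarrow> cg P g u \<eta> \<delta> w w'"

definition CG :: "'a::real_inner set \<Rightarrow> 'a \<Rightarrow> 'a \<Rightarrow> real \<Rightarrow> real \<Rightarrow> 'a \<Rightarrow> bool" where
  "CG P g u \<eta> \<delta> w \<longleftrightarrow> cg P g u \<eta> \<delta> u w"

definition bregman :: "('a::real_inner \<Rightarrow> real) \<Rightarrow> ('a \<Rightarrow> 'a) \<Rightarrow> 'a \<Rightarrow> 'a \<Rightarrow> real" where
  "bregman f g x y = f x - f y - g y \<bullet> (x - y)"

text \<open>Used for indices \<open>k \<ge> 1\<close> and \<open>x 1 \<noteq> x 0\<close>; for convex \<open>f\<close> the Bregman distance is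
  nonnegative, so the last case is the one of a positive distance.\<close>

definition lip_est :: "('a::real_inner \<Rightarrow> real) \<Rightarrow> ('a \<Rightarrow> 'a) \<Rightarrow> (nat \<Rightarrow> 'a) \<Rightarrow> nat \<Rightarrow> real" where
  "lip_est f g x k =
     (if k = 1 then norm (g (x 1) - g (x 0)) / norm (x 1 - x 0)
      else if bregman f g (x (k - 1)) (x k) = 0 then 0
      else (norm (g (x k) - g (x (k - 1))))\<^sup>2 / (2 * bregman f g (x (k - 1)) (x k)))"

text \<open>A run of \<open>N\<close> outer iterations of AdCGS with given parameter sequences; the stepsize rule
  is not part of this predicate.\<close>

definition adcgs ::
  "'a::real_inner set \<Rightarrow> ('a \<Rightarrow> 'a) \<Rightarrow> (nat \<Rightarrow> real) \<Rightarrow> (nat \<Rightarrow> real) \<Rightarrow> (nat \<Rightarrow> real) \<Rightarrow> (nat \<Rightarrow> real)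
     \<Rightarrow> nat \<Rightarrow> (nat \<Rightarrow> 'a) \<Rightarrow> (nat \<Rightarrow> 'a) \<Rightarrow> (nat \<Rightarrow> 'a) \<Rightarrow> bool" where
  "adcgs P g \<beta> \<delta> \<eta> \<tau> N x y z \<longleftrightarrow>
     x 0 \<in> P \<and> y 0 = x 0 \<and> z 0 = x 0 \<and>
     (\<forall>k\<in>{1..N}.
        0 \<le> \<beta> k \<and> \<beta> k \<le> 1 \<and> 0 < \<delta> k \<and> 0 < \<eta> k \<and> 0 \<le> \<tau> k \<and>
        CG P (g (x (k - 1))) (y (k - 1)) (\<eta> k) (\<delta> k) (z k) \<and>
        y k = (1 - \<beta> k) *\<^sub>R y (k - 1) + \<beta> k *\<^sub>R z k \<and>
        x k = (\<tau> k / (1 + \<tau> k)) *\<^sub>R x (k - 1) + (1 / (1 + \<tau> k)) *\<^sub>R z k)"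

end

theory Submission
  imports Defs
begin

text \<open>With \<open>F\<^sub>k = f x\<^sub>k - f x\<^sup>*\<close>, the potential
  \<open>\<eta>\<^sub>k (1 + \<tau>\<^bsub>k-1\<^esub>) F\<^bsub>k-1\<^esub> + \<parallel>y\<^sub>k - x\<^sup>*\<parallel>\<^sup>2 / (2\<beta>) + \<parallel>z\<^sub>k - y\<^bsub>k-1\<^esub>\<parallel>\<^sup>2 / 4\<close>
  grows by at most \<open>\<eta>\<^sub>k (\<delta>\<^sub>k + \<delta>\<^bsub>k-1\<^esub>)\<close> per step. To see this, the gap inequality of step \<open>k\<close> is
  tested at \<open>x\<^sup>*\<close> and that of step \<open>k - 1\<close> at \<open>z\<^sub>k\<close>; the gradient difference this leaves is absorbed
  by the Bregman distance that defines \<open>L\<^bsub>k-1\<^esub>\<close> and by a quarter of the squared prox steps.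
  The stepsizes lie between \<open>k / (12 Lhat)\<close> and \<open>k (1 - \<beta>) \<eta>\<^sub>1 / 3\<close>, which turns the potential at
  \<open>k = N + 1\<close> into the rate. The constant \<open>E\<close> may be negative because \<open>\<delta>\<^sub>1\<close> does not scale with
  \<open>1 / \<eta>\<^sub>1\<close>; the first gap inequality, tested at \<open>x\<^sup>*\<close>, gives the lower bound on \<open>E\<close> needed to
  replace the factor \<open>N / (N + 2)\<close> by 1.\<close>

text \<open>Restricting \<open>f\<close> to the line through \<open>y\<close> and \<open>x\<close>
  reduces the claim to the tangent inequality for convex functions of one real variable.\<close>

lemma convex_gderiv_above_tangent:
  fixes f :: "'a::real_inner \<Rightarrow> real"
  assumes f: "convex_on UNIV f" and D: "GDERIV f y :> d"
  shows "f y + d \<bullet> (x - y) \<le> f x"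
proof -
  define \<phi> where "\<phi> t = f (y + t *\<^sub>R (x - y))" for t :: real
  have conv: "convex_on UNIV \<phi>"
  proof (rule convex_onI)
    fix t a b :: real
    assume "0 < t" "t < 1"
    moreover have "y + ((1 - t) *\<^sub>R a + t *\<^sub>R b) *\<^sub>R (x - y)
        = (1 - t) *\<^sub>R (y + a *\<^sub>R (x - y)) + t *\<^sub>R (y + b *\<^sub>R (x - y))"
      by (simp add: algebra_simps)
    ultimately show "\<phi> ((1 - t) *\<^sub>R a + t *\<^sub>R b) \<le> (1 - t) * \<phi> a + t * \<phi> b"
      unfolding \<phi>_def using convex_onD[OF f, of t] by simp
  qed simp
  have "(f has_derivative (\<lambda>h. h \<bullet> d)) (at (y + 0 *\<^sub>R (x - y)))"
    using D by (simp add: gderiv_def)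
  moreover have "((\<lambda>t. y + t *\<^sub>R (x - y)) has_derivative (\<lambda>t. t *\<^sub>R (x - y))) (at 0)"
    by (auto intro!: derivative_eq_intros)
  ultimately have "(\<phi> has_derivative (\<lambda>t. t *\<^sub>R (x - y) \<bullet> d)) (at 0)"
    unfolding \<phi>_def by (rule has_derivative_compose[rotated])
  then have "(\<phi> has_real_derivative d \<bullet> (x - y)) (at 0)"
    by (simp add: has_field_derivative_def inner_commute mult_commute_abs)
  with convex_on_imp_above_tangent[OF conv, where c=0 and x=1 and f'="d \<bullet> (x - y)"]
  show ?thesis
    by (simp add: \<phi>_def)
qed

lemma bregman_nonneg:
  assumes "convex_on UNIV f" "\<And>w. GDERIV f w :> g w"
  shows "0 \<le> bregman f g x y"
  using convex_gderiv_above_tangent[OF assms(1) assms(2)[of y], of x] by (simp add: bregman_def)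

text \<open>By the tangent inequality at \<open>y\<close>, a vanishing Bregman distance makes
  \<open>x\<close> a global minimizer of the tilted function \<open>?h\<close>, so the gradient
  \<open>g x - g y\<close> of \<open>?h\<close> at \<open>x\<close> is zero.\<close>

lemma bregman_eq_0_imp_gradient_eq:
  assumes f: "convex_on UNIV f" and D: "\<And>w. GDERIV f w :> g w" and 0: "bregman f g x y = 0"
  shows "g x = g y"
proof -
  let ?h = "\<lambda>w. f w - w \<bullet> g y"
  have "(?h has_derivative (\<lambda>v. v \<bullet> g x - v \<bullet> g y)) (at x)"
    using D[of x] unfolding gderiv_def by (auto intro!: derivative_eq_intros)
  moreover have "?h x \<le> ?h w" for w
    using convex_gderiv_above_tangent[OF f D[of y], of w] 0
    by (simp add: bregman_def inner_diff_right inner_commute)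
  ultimately have "(\<lambda>v. v \<bullet> g x - v \<bullet> g y) = (\<lambda>v. 0)"
    by (intro has_derivative_local_min[of ?h]) auto
  then have "(g x - g y) \<bullet> (g x - g y) = 0"
    by (simp add: inner_diff_right fun_eq_iff)
  then show ?thesis by simp
qed

lemma lip_est_nonneg:
  assumes "convex_on UNIV f" "\<And>w. GDERIV f w :> g w"
  shows "0 \<le> lip_est f g x k"
  using bregman_nonneg[OF assms, where x="x (k - 1)" and y="x k"] by (auto simp: lip_est_def)

text \<open>The default value 0 of the estimate is harmless: where the Bregman distance vanishes,
  the two gradients agree. The index 1 is excluded because \<open>L 1\<close> is a quotient of
  norms.\<close>

lemma gradient_diff_eq_lip_est_bregman:
  assumes "convex_on UNIV f" "\<And>w. GDERIV f w :> g w" "k \<noteq> 1"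
  shows "(norm (g (x k) - g (x (k - 1))))\<^sup>2
    = 2 * lip_est f g x k * bregman f g (x (k - 1)) (x k)"
  using bregman_eq_0_imp_gradient_eq[OF assms(1,2), where x="x (k - 1)" and y="x k"] assms(3)
  by (auto simp: lip_est_def)

lemma bdd_above_image_inner_diff:
  fixes a w :: "'a::real_inner"
  assumes "compact P"
  shows "bdd_above ((\<lambda>v. a \<bullet> (w - v)) ` P)"
  by (intro bounded_imp_bdd_above compact_imp_bounded compact_continuous_image assms continuous_intros)

text \<open>The gap at a linear minimizer is nonnegative, so \<open>\<gamma>\<close> lies in [0, 1]
  and every iterate stays in the convex set \<open>P\<close>. The stopping test gives the gap bound
  pointwise, since compactness bounds the supremum.\<close>

lemma cg_in_and_gap:
  assumes "cg P g u \<eta> \<delta> w w'" and P: "compact P" "convex P" and \<eta>: "0 < \<eta>" and w: "w \<in> P"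
  shows "w' \<in> P \<and> (\<forall>v\<in>P. (g + (1 / \<eta>) *\<^sub>R (w' - u)) \<bullet> (w' - v) \<le> \<delta>)"
  using assms(1) w
proof (induction rule: cg.induct)
  case (return w)
  then show ?case
    using cSUP_upper[OF _ bdd_above_image_inner_diff[OF P(1)]] by (blast intro: order_trans)
next
  case (step w v \<gamma> w')
  let ?a = "g + (1 / \<eta>) *\<^sub>R (w - u)"
  have v: "v \<in> P" "?a \<bullet> v \<le> ?a \<bullet> w"
    using step.hyps(1) step.prems by (auto simp: is_arg_min_linorder)
  then have "0 \<le> ?a \<bullet> (w - v)"
    by (simp add: inner_diff_right)
  then have "0 \<le> \<gamma>" "\<gamma> \<le> 1"
    using step.hyps(3) \<eta> by auto
  then have "(1 - \<gamma>) *\<^sub>R w + \<gamma> *\<^sub>R v \<in> P"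
    using P(2) v step.prems by (simp add: convexD)
  then show ?case by (rule step.IH)
qed

lemma CG_in:
  assumes "CG P g u \<eta> \<delta> w" "compact P" "convex P" "0 < \<eta>" "u \<in> P"
  shows "w \<in> P"
  using assms cg_in_and_gap unfolding CG_def by blast

lemma CG_gap:
  assumes "CG P g u \<eta> \<delta> w" "compact P" "convex P" "0 < \<eta>" "u \<in> P" "v \<in> P"
  shows "\<eta> * (g \<bullet> (w - v)) + (w - u) \<bullet> (w - v) \<le> \<eta> * \<delta>"
proof -
  have "\<eta> * ((g + (1 / \<eta>) *\<^sub>R (w - u)) \<bullet> (w - v)) \<le> \<eta> * \<delta>"
    using assms cg_in_and_gap unfolding CG_def by (metis less_imp_le mult_left_mono)
  with \<open>0 < \<eta>\<close> show ?thesis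
    by (simp add: inner_add_left distrib_left)
qed

text \<open>Translates the stepsize rule to the reals. The bound by the quotient is multiplied out
  so that it also covers \<open>c = 0\<close>; the attained alternative serves the lower bounds on
  the stepsizes.\<close>

lemma ereal_eq_min_divide:
  fixes e a b c :: real
  assumes e: "ereal e = min (ereal a) (ereal b / ereal c)" and "0 < b" "0 \<le> c"
  shows "e \<le> a" "e * c \<le> b" "e = a \<or> 0 < c \<and> e = b / c"
proof -
  have "e \<le> a \<and> e * c \<le> b \<and> (e = a \<or> 0 < c \<and> e = b / c)"
  proof (cases "c = 0")
    case True
    with e \<open>0 < b\<close> have "e = a" by simp
    with True \<open>0 < b\<close> show ?thesis by simp
  next
    case False
    with \<open>0 \<le> c\<close> have "0 < c" by simp
    with e have "ereal e = ereal (min a (b / c))" by simp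
    then have "e = min a (b / c)" by (simp only: ereal.inject)
    with \<open>0 < c\<close> show ?thesis
      by (auto simp: min_def field_simps)
  qed
  then show "e \<le> a" "e * c \<le> b" "e = a \<or> 0 < c \<and> e = b / c" by auto
qed

text \<open>Expanding the square of \<open>e + \<beta> *\<^sub>R p\<close> turns the prox term of a
  gap inequality into distances of consecutive averages to \<open>u\<close>, which telescope, and a
  positive multiple of the squared prox step.\<close>

lemma averaged_prox_identity:
  fixes y z u :: "'a::real_inner"
  assumes "\<beta> \<noteq> 0"
  shows "(z - y) \<bullet> (z - u)
    = 1 / (2 * \<beta>) * (norm ((1 - \<beta>) *\<^sub>R y + \<beta> *\<^sub>R z - u))\<^sup>2 - 1 / (2 * \<beta>) * (norm (y - u))\<^sup>2
      + (1 - \<beta> / 2) * (norm (z - y))\<^sup>2"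
proof -
  define p e where "p = z - y" and "e = y - u"
  have eq: "(1 - \<beta>) *\<^sub>R y + \<beta> *\<^sub>R z - u = e + \<beta> *\<^sub>R p" "z - u = p + e"
    by (simp_all add: p_def e_def algebra_simps)
  show ?thesis
    unfolding eq p_def[symmetric] e_def[symmetric] power2_norm_eq_inner using assms
    by (simp add: inner_add_left inner_add_right inner_commute field_simps)
qed

text \<open>Step 2, with primes for step 1. Both steps have the same prox center since
  \<open>\<beta>s 1 = 0\<close>, and \<open>L 1\<close> is a quotient of norms, so Cauchy-Schwarz
  controls the gradient difference here.\<close>

lemma first_averaged_step:
  fixes a b u y z z' :: "'a::real_inner"
  assumes A: "\<eta> * (a \<bullet> (z - u)) + (z - y) \<bullet> (z - u) \<le> \<eta> * \<epsilon>"
    and B: "\<eta>' * (b \<bullet> (z' - z)) + (z' - y) \<bullet> (z' - z) \<le> \<eta>' * \<epsilon>'"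
    and \<beta>: "0 < \<beta>" and pos: "0 < \<eta>" "0 < \<eta>'" and \<eta>: "\<eta> \<le> (1 - \<beta>) * \<eta>'"
    and L: "norm (a - b) \<le> L * norm (z' - y)" "0 \<le> L" "4 * L * \<eta> \<le> 1"
  shows "\<eta> * (a \<bullet> (z' - u)) + 1 / (2 * \<beta>) * (norm ((1 - \<beta>) *\<^sub>R y + \<beta> *\<^sub>R z - u))\<^sup>2
      + (norm (z - y))\<^sup>2 / 4
    \<le> 1 / (2 * \<beta>) * (norm (y - u))\<^sup>2 + \<eta> / 2 * (5 * L / 2 - 1 / \<eta>') * (norm (z' - y))\<^sup>2
      + \<eta> * (\<epsilon> + \<epsilon>')"
proof -
  define p q d \<rho> l where "p = z - y" and "q = z' - y" and "d = a - b"
    and "\<rho> = \<eta> / \<eta>'" and "l = L * \<eta>"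
  define W where "W = (3 / 4 - \<beta> / 2) * (norm p)\<^sup>2"
  \<comment> \<open>Rescaling by the ratio of the stepsizes puts the same weight on both gradients,
    so that their difference \<open>d\<close> can be isolated.\<close>
  have "\<rho> * (\<eta>' * (b \<bullet> (z' - z)) + (z' - y) \<bullet> (z' - z)) \<le> \<rho> * (\<eta>' * \<epsilon>')"
    using B pos by (intro mult_left_mono) (auto simp: \<rho>_def)
  then have B': "\<eta> * (b \<bullet> (z' - z)) + \<rho> * (q \<bullet> (q - p)) \<le> \<eta> * \<epsilon>'"
    using pos by (simp add: \<rho>_def p_def q_def distrib_left)
  have "\<eta> * \<bar>d \<bullet> (p - q)\<bar> \<le> \<eta> * ((L * norm q) * (norm p + norm q))"
    using pos L(1) norm_triangle_ineq4[of p q] Cauchy_Schwarz_ineq2[of d "p - q"]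
    by (intro mult_left_mono order_trans[OF Cauchy_Schwarz_ineq2] mult_mono)
      (auto simp: d_def q_def L(2))
  then have d: "\<eta> * (d \<bullet> (p - q)) \<ge> - (l * (norm p * norm q)) - l * (norm q)\<^sup>2"
    using abs_ge_minus_self[of "d \<bullet> (p - q)"] pos
    by (smt (verit) l_def mult.commute mult.left_commute distrib_left power2_eq_square mult_minus_right mult_left_mono)
  have "0 \<le> l" "l \<le> 1/4"
    using L pos by (simp_all add: l_def algebra_simps)
  have \<rho>: "0 \<le> \<rho>" "\<rho> \<le> 1 - \<beta>"
    using pos \<eta> by (simp_all add: \<rho>_def field_simps)
  have polar: "q \<bullet> (q - p) = ((norm q)\<^sup>2 + (norm (q - p))\<^sup>2 - (norm p)\<^sup>2) / 2"
    by (simp add: power2_norm_eq_inner inner_diff_left inner_diff_right inner_commute)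
  \<comment> \<open>The middle coefficient is nonnegative because
    \<open>\<rho> \<le> 1 - \<beta>\<close> and \<open>l \<le> 1/4\<close>. The \<open>l / 4\<close>
    from the first square and the \<open>l\<close> from \<open>d\<close> add up to
    \<open>5 / 4 * l\<close>, the source of \<open>5 * L / 2\<close> in \<open>E\<close>.\<close>
  have "0 \<le> l * (norm p - norm q / 2)\<^sup>2 + (3 / 4 - \<beta> / 2 - \<rho> / 2 - l) * (norm p)\<^sup>2
      + \<rho> / 2 * (norm (q - p))\<^sup>2"
    using \<open>0 \<le> l\<close> \<open>l \<le> 1/4\<close> \<rho> by (intro add_nonneg_nonneg mult_nonneg_nonneg) auto
  also have "\<dots> = (3 / 4 - \<beta> / 2) * (norm p)\<^sup>2 + \<rho> * (q \<bullet> (q - p)) - l * (norm p * norm q)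
      + l / 4 * (norm q)\<^sup>2 - \<rho> / 2 * (norm q)\<^sup>2"
    unfolding polar by (simp add: power2_diff field_simps)
  finally have Q: "0 \<le> W + \<rho> * (q \<bullet> (q - p)) + \<eta> * (d \<bullet> (p - q))
      + 5 / 4 * (l * (norm q)\<^sup>2) - \<rho> / 2 * (norm q)\<^sup>2"
    using d by (simp add: W_def algebra_simps)
  have "\<eta> * (a \<bullet> (z - u)) + \<eta> * (b \<bullet> (z' - z)) = \<eta> * (a \<bullet> (z' - u)) + \<eta> * (d \<bullet> (p - q))"
    by (simp add: d_def p_def q_def inner_diff_left inner_diff_right algebra_simps)
  moreover have "\<eta> / 2 * (5 * L / 2 - 1 / \<eta>') * (norm q)\<^sup>2
      = 5 / 4 * (l * (norm q)\<^sup>2) - \<rho> / 2 * (norm q)\<^sup>2"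
    by (simp add: l_def \<rho>_def algebra_simps)
  moreover have "(1 - \<beta> / 2) * (norm p)\<^sup>2 = W + (norm p)\<^sup>2 / 4"
    by (simp add: W_def field_simps)
  ultimately show ?thesis
    using A B' Q averaged_prox_identity[of \<beta> z y u] \<beta> unfolding p_def[symmetric] q_def[symmetric]
    by argo
qed

text \<open>Later steps, with primes for the preceding one. The prox center has moved, so
  \<open>z' - z\<close> becomes \<open>s *\<^sub>R q - p\<close>; the squared gradient difference is
  kept, to be compared with a Bregman distance.\<close>

lemma averaged_step:
  fixes a b u y\<^sub>0 y z z' :: "'a::real_inner"
  assumes A: "\<eta> * (a \<bullet> (z - u)) + (z - y) \<bullet> (z - u) \<le> \<eta> * \<epsilon>"
    and B: "\<eta>' * (b \<bullet> (z' - z)) + (z' - y\<^sub>0) \<bullet> (z' - z) \<le> \<eta>' * \<epsilon>'"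
    and y: "y = (1 - \<beta>) *\<^sub>R y\<^sub>0 + \<beta> *\<^sub>R z'"
    and \<beta>: "0 < \<beta>" "\<beta> < 1" and pos: "0 < \<eta>" "0 < \<eta>'" and \<eta>: "\<eta> \<le> 2 * (1 - \<beta>)\<^sup>2 * \<eta>'"
  shows "\<eta> * (a \<bullet> (z' - u)) + 1 / (2 * \<beta>) * (norm ((1 - \<beta>) *\<^sub>R y + \<beta> *\<^sub>R z - u))\<^sup>2
      + (norm (z - y))\<^sup>2 / 4
    \<le> 1 / (2 * \<beta>) * (norm (y - u))\<^sup>2 + (norm (z' - y\<^sub>0))\<^sup>2 / 4 + 2 * \<eta>\<^sup>2 * (norm (a - b))\<^sup>2
      + \<eta> * (\<epsilon> + \<epsilon>')"
proof -
  define p q d \<rho> s where "p = z - y" and "q = z' - y\<^sub>0" and "d = a - b"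
    and "\<rho> = \<eta> / \<eta>'" and "s = 1 - \<beta>"
  have s: "0 < s" "s < 1" and \<beta>_eq: "\<beta> = 1 - s"
    using \<beta> by (simp_all add: s_def)
  have z'z: "z' - z = s *\<^sub>R q - p"
    by (simp add: p_def q_def s_def y algebra_simps)
  have "\<rho> * (\<eta>' * (b \<bullet> (z' - z)) + (z' - y\<^sub>0) \<bullet> (z' - z)) \<le> \<rho> * (\<eta>' * \<epsilon>')"
    using B pos by (intro mult_left_mono) (auto simp: \<rho>_def)
  then have B': "\<eta> * (b \<bullet> (z' - z)) + \<rho> * (q \<bullet> (s *\<^sub>R q - p)) \<le> \<eta> * \<epsilon>'"
    using pos by (simp add: \<rho>_def q_def[symmetric] z'z distrib_left)
  have \<rho>: "0 \<le> \<rho>" "\<rho> \<le> 2 * s\<^sup>2"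
    using pos \<eta> by (simp_all add: \<rho>_def s_def field_simps)
  have "s\<^sup>2 \<le> 1" "\<rho> / (4 * s) \<le> s / 2"
    using s \<rho> power_le_one[of s 2] by (simp_all add: field_simps power2_eq_square)
  \<comment> \<open>The first two terms complete the square in the rescaled prox term and need
    \<open>\<rho> \<le> 2 * s\<^sup>2\<close>. The last three are a Young inequality for
    \<open>d\<close>, charged to a quarter of each squared prox step.\<close>
  then have "0 \<le> \<rho> / (4 * s) * (norm (p - (2 * s) *\<^sub>R q))\<^sup>2 + (s / 2 - \<rho> / (4 * s)) * (norm p)\<^sup>2
      + (norm (p + s *\<^sub>R q))\<^sup>2 / 8 + (1 / 4 - s\<^sup>2 / 4) * (norm q)\<^sup>2
      + (norm ((4 * \<eta>) *\<^sub>R d + (p - s *\<^sub>R q)))\<^sup>2 / 8"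
    using s \<rho> by (intro add_nonneg_nonneg mult_nonneg_nonneg) auto
  also have "\<dots> = (1 / 4 + s / 2) * (norm p)\<^sup>2 + \<rho> * (q \<bullet> (s *\<^sub>R q - p)) + (norm q)\<^sup>2 / 4
      + 2 * \<eta>\<^sup>2 * (norm d)\<^sup>2 + \<eta> * (d \<bullet> (p - s *\<^sub>R q))"
    unfolding power2_norm_eq_inner using s
    by (simp add: inner_diff_left inner_diff_right inner_add_left inner_add_right
        inner_commute[of q p] inner_commute[of p d] inner_commute[of q d] field_simps power2_eq_square)
  finally have Q: "0 \<le> (1 / 4 + s / 2) * (norm p)\<^sup>2 + \<rho> * (q \<bullet> (s *\<^sub>R q - p)) + (norm q)\<^sup>2 / 4
      + 2 * \<eta>\<^sup>2 * (norm d)\<^sup>2 + \<eta> * (d \<bullet> (p - s *\<^sub>R q))" .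
  have "a \<bullet> (z - u) + b \<bullet> (z' - z) = a \<bullet> (z' - u) - d \<bullet> (z' - z)"
    by (simp add: d_def inner_diff_left inner_diff_right)
  then have "\<eta> * (a \<bullet> (z - u)) + \<eta> * (b \<bullet> (z' - z))
      = \<eta> * (a \<bullet> (z' - u)) + \<eta> * (d \<bullet> (p - s *\<^sub>R q))"
    unfolding z'z by (metis distrib_left diff_conv_add_uminus inner_minus_right minus_diff_eq)
  moreover have "(1 - \<beta> / 2) * (norm p)\<^sup>2 = (1 / 4 + s / 2) * (norm p)\<^sup>2 + (norm p)\<^sup>2 / 4"
    by (simp add: \<beta>_eq field_simps)
  ultimately show ?thesis
    using A B' Q averaged_prox_identity[of \<beta> z y u] \<beta>
    unfolding p_def[symmetric] q_def[symmetric] d_def[symmetric]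
    by (simp add: distrib_left)
qed

text \<open>Splitting \<open>z - u\<close> into \<open>w - u\<close> and
  \<open>- \<tau> *\<^sub>R (w' - w)\<close> allows the tangent inequality on the first part, while
  the second is a Bregman distance exactly. The surplus \<open>\<tau> * bregman f g w' w\<close>
  later pays for the gradient difference.\<close>

lemma extrapolated_gradient_inequality:
  assumes f: "convex_on UNIV f" and D: "GDERIV f w :> g w"
    and w: "(1 + \<tau>) *\<^sub>R w = \<tau> *\<^sub>R w' + z"
  shows "(1 + \<tau>) * (f w - f u) + \<tau> * bregman f g w' w \<le> g w \<bullet> (z - u) + \<tau> * (f w' - f u)"
proof -
  have "z - u = (w - u) - \<tau> *\<^sub>R (w' - w)"
    using w by (simp add: algebra_simps)
  then have "g w \<bullet> (z - u) = g w \<bullet> (w - u) - \<tau> * (g w \<bullet> (w' - w))"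
    by (simp add: inner_diff_right)
  then show ?thesis
    using convex_gderiv_above_tangent[OF f D, of u]
    by (simp add: bregman_def inner_diff_right algebra_simps)
qed

text \<open>Bounds the possibly negative part of \<open>E\<close>. Here \<open>a\<close> and
  \<open>b\<close> are the gradients at \<open>z\<close> and \<open>y\<close>; the sign condition on
  \<open>a\<close> comes from minimality of \<open>u\<close>, and passing from \<open>a\<close> to
  \<open>b\<close> costs a multiple of \<open>L\<close>.\<close>

lemma first_step_length:
  fixes a b u y z :: "'a::real_inner"
  assumes gap: "\<eta> * (b \<bullet> (z - u)) + (z - y) \<bullet> (z - u) \<le> \<eta> * \<epsilon>"
    and a: "0 \<le> a \<bullet> (z - u)" and L: "norm (a - b) \<le> L * norm (z - y)" "0 \<le> L"
    and \<eta>: "0 < \<eta>" and l: "5 * (\<eta> * L) \<le> 2"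
  shows "(1 - 5 / 2 * (\<eta> * L)) * (norm (z - y))\<^sup>2
    \<le> 5 / 4 * (\<eta> * \<epsilon>) + 15 / 8 * (norm (y - u))\<^sup>2"
proof -
  define r D l where "r = norm (z - y)" and "D = norm (y - u)" and "l = \<eta> * L"
  have "norm (z - u) \<le> r + D"
    unfolding r_def D_def by (metis norm_triangle_sub diff_add_cancel norm_triangle_ineq add_diff_eq)
  then have "\<bar>(a - b) \<bullet> (z - u)\<bar> \<le> (L * r) * (r + D)"
    using L by (intro order_trans[OF Cauchy_Schwarz_ineq2] mult_mono) (auto simp: r_def)
  with a have "- (L * r * (r + D)) \<le> b \<bullet> (z - u)"
    by (simp add: inner_diff_left)
  then have "\<eta> * (- (L * r * (r + D))) \<le> \<eta> * (b \<bullet> (z - u))"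
    using \<eta> by (intro mult_left_mono) auto
  moreover have "(z - y) \<bullet> (z - u) = r\<^sup>2 + (z - y) \<bullet> (y - u)"
    by (simp add: r_def power2_norm_eq_inner inner_diff_right)
  moreover have "- (r * D) \<le> (z - y) \<bullet> (y - u)"
    using Cauchy_Schwarz_ineq2[of "z - y" "y - u"] by (simp add: r_def D_def)
  ultimately have key: "(1 - l) * r\<^sup>2 - (1 + l) * (r * D) \<le> \<eta> * \<epsilon>"
    using gap by (simp add: l_def algebra_simps power2_eq_square)
  have l: "0 \<le> l" "l \<le> 2 / 5"
    using L \<eta> l by (auto simp: l_def)
  have sq: "5 / 6 * (1 + l)\<^sup>2 \<le> 1 + 5 * l"
  proof -
    have "l * l \<le> l * (2/5)" using l by (intro mult_left_mono) auto
    moreover have "(1 + l)\<^sup>2 = 1 + 2 * l + l * l"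
      by (simp add: power2_eq_square algebra_simps)
    ultimately show ?thesis using l by linarith
  qed
  \<comment> \<open>This square cancels the mixed term of \<open>5 / 4\<close> times
    \<open>key\<close>. The coefficients of \<open>r\<^sup>2\<close> then match because
    \<open>(1 - 5 / 2 * l) + (1 + 5 * l) / 4 = 5 / 4 * (1 - l)\<close>.\<close>
  have "0 \<le> 15 / 8 * (D - (1 + l) * r / 3)\<^sup>2"
    by simp
  also have "\<dots> = 1 / 4 * (5 / 6 * (1 + l)\<^sup>2) * r\<^sup>2 - 5 / 4 * ((1 + l) * (r * D)) + 15 / 8 * D\<^sup>2"
    by (simp add: power2_eq_square field_simps)
  also have "\<dots> \<le> 1 / 4 * (1 + 5 * l) * r\<^sup>2 - 5 / 4 * ((1 + l) * (r * D)) + 15 / 8 * D\<^sup>2"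
    using sq by (intro add_right_mono diff_right_mono mult_right_mono mult_left_mono) auto
  finally have "(1 - 5 / 2 * l) * r\<^sup>2 \<le> 5 / 4 * ((1 - l) * r\<^sup>2 - (1 + l) * (r * D)) + 15 / 8 * D\<^sup>2"
    by (simp add: algebra_simps)
  also have "\<dots> \<le> 5 / 4 * (\<eta> * \<epsilon>) + 15 / 8 * D\<^sup>2"
    using key by (intro add_right_mono mult_left_mono) auto
  finally show ?thesis
    unfolding r_def D_def l_def .
qed

text \<open>From index 3 on, \<open>\<eta> k / k\<close> does not increase.\<close>

lemma stepsize_upper:
  fixes \<eta> :: "nat \<Rightarrow> real"
  assumes "\<eta> 3 \<le> h" and "\<And>k. 4 \<le> k \<Longrightarrow> k \<le> M \<Longrightarrow> \<eta> k \<le> real k / (real k - 1) * \<eta> (k - 1)"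
    and "3 \<le> k" "k \<le> M"
  shows "\<eta> k \<le> real k / 3 * h"
  using assms(3,4)
proof (induction k rule: dec_induct)
  case base
  then show ?case using assms(1) by simp
next
  case (step k)
  have "\<eta> (Suc k) \<le> real (Suc k) / real k * \<eta> k"
    using assms(2)[of "Suc k"] step by simp
  also have "\<dots> \<le> real (Suc k) / real k * (real k / 3 * h)"
    using step by (intro mult_left_mono) auto
  also have "\<dots> = real (Suc k) / 3 * h"
    using step by simp
  finally show ?case .
qed

text \<open>Either \<open>\<eta> k / k\<close> is preserved, or the stepsize is reset by the local
  estimate; the reset value suffices because \<open>8 * (k + 1) \<le> 12 * k\<close> for
  \<open>k \<ge> 2\<close>.\<close>

lemma stepsize_lower:
  fixes \<eta> L :: "nat \<Rightarrow> real"
  assumes "0 < Lhat" and L: "\<And>i. 3 \<le> i \<Longrightarrow> i < M \<Longrightarrow> L i \<le> Lhat"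
    and base: "1 / (4 * Lhat) \<le> \<eta> 3"
    and rule: "\<And>k. 4 \<le> k \<Longrightarrow> k \<le> M \<Longrightarrow> \<eta> k = real k / (real k - 1) * \<eta> (k - 1)
      \<or> 0 < 8 * L (k - 1) \<and> \<eta> k = (real k - 1) / (8 * L (k - 1))"
    and "3 \<le> k" "k \<le> M"
  shows "real k / (12 * Lhat) \<le> \<eta> k"
  using assms(5,6)
proof (induction k rule: dec_induct)
  case base
  then show ?case using assms(3) by simp
next
  case (step k)
  consider "\<eta> (Suc k) = real (Suc k) / real k * \<eta> k"
    | "0 < L k" "\<eta> (Suc k) = real k / (8 * L k)"
    using rule[of "Suc k"] step by auto
  then show ?case
  proof cases
    case 1
    have "real (Suc k) / (12 * Lhat) = real (Suc k) / real k * (real k / (12 * Lhat))"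
      using step by simp
    also have "\<dots> \<le> real (Suc k) / real k * \<eta> k"
      using step by (intro mult_left_mono) auto
    finally show ?thesis using 1 by simp
  next
    case 2
    have "real (Suc k) / (12 * Lhat) \<le> real k / (8 * Lhat)"
      using \<open>0 < Lhat\<close> step by (simp add: field_simps)
    also have "\<dots> \<le> real k / (8 * L k)"
      using 2 L[of k] step \<open>0 < Lhat\<close> by (intro divide_left_mono) auto
    finally show ?thesis using 2 by simp
  qed
qed

text \<open>The factors \<open>k\<close> and \<open>1 / k\<close> cancel, so the terms are nearly
  constant: about \<open>2 / 3 * h * C\<close>, and at most \<open>3 / 4 * h * C\<close> from index
  5 on. Hence the induction starts at 4, after direct bounds for the first sums.\<close>

lemma weighted_accuracy_sum:
  fixes \<eta> \<delta> :: "nat \<Rightarrow> real"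
  assumes "0 \<le> h" "0 \<le> C" and \<delta>: "\<And>k. 1 \<le> k \<Longrightarrow> k \<le> M \<Longrightarrow> \<delta> k = C / real k"
    and "\<eta> 2 \<le> h" and \<eta>: "\<And>k. 3 \<le> k \<Longrightarrow> k \<le> M \<Longrightarrow> \<eta> k \<le> real k / 3 * h"
    and "2 \<le> k" "k \<le> M"
  shows "(\<Sum>j=2..k. \<eta> j * (\<delta> j + \<delta> (j - 1))) \<le> h * C * (3 / 4 * real k + 1 / 4)"
proof -
  have first: "\<eta> 2 * (\<delta> 2 + \<delta> 1) \<le> h * C * (3 / 2)"
  proof -
    have "\<eta> 2 * (\<delta> 2 + \<delta> 1) = \<eta> 2 * (C * (3 / 2))"
      using \<delta>[of 1] \<delta>[of 2] assms(6,7) by simp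
    also have "\<dots> \<le> h * (C * (3 / 2))"
      using assms by (intro mult_right_mono) auto
    finally show ?thesis by simp
  qed
  have later: "\<eta> j * (\<delta> j + \<delta> (j - 1)) \<le> h * C * (2 / 3 + 1 / (3 * (real j - 1)))"
    if "3 \<le> j" "j \<le> M" for j
  proof -
    have \<delta>j: "\<delta> j + \<delta> (j - 1) = C / real j + C / (real j - 1)"
      using \<delta>[of j] \<delta>[of "j - 1"] that by (simp add: of_nat_diff)
    have "\<eta> j * (\<delta> j + \<delta> (j - 1)) \<le> real j / 3 * h * (\<delta> j + \<delta> (j - 1))"
      using that assms(2) unfolding \<delta>j by (intro mult_right_mono \<eta> add_nonneg_nonneg) auto
    also have "\<dots> = h * C * (2 / 3 + 1 / (3 * (real j - 1)))"
      unfolding \<delta>j using that by (simp add: field_simps)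
    finally show ?thesis .
  qed
  have hC: "0 \<le> h * C"
    using assms by simp
  define S where "S k = (\<Sum>j=2..k. \<eta> j * (\<delta> j + \<delta> (j - 1)))" for k
  have S_Suc: "S (Suc k) = S k + \<eta> (Suc k) * (\<delta> (Suc k) + \<delta> k)" if "1 \<le> k" for k
    using that by (simp add: S_def)
  have S2: "S 2 \<le> h * C * (3 / 2)"
    using first by (simp add: S_def)
  have S3: "S 3 \<le> h * C * (7 / 3)" if "3 \<le> M"
    using S2 S_Suc[of 2] later[of 3] that by (simp add: eval_nat_numeral)
  have S4: "S 4 \<le> h * C * (28 / 9)" if "4 \<le> M"
    using S3 S_Suc[of 3] later[of 4] that by (simp add: eval_nat_numeral)
  have S: "S k \<le> h * C * (3 / 4 * real k + 1 / 4)" if "4 \<le> k" "k \<le> M" for k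
    using that
  proof (induction k rule: dec_induct)
    case base
    have "S 4 \<le> h * C * (28 / 9)" using S4 base by simp
    also have "\<dots> \<le> h * C * (3 / 4 * real 4 + 1 / 4)"
      using hC by (intro mult_left_mono) auto
    finally show ?case .
  next
    case (step k)
    have "\<eta> (Suc k) * (\<delta> (Suc k) + \<delta> k) \<le> h * C * (2 / 3 + 1 / (3 * real k))"
      using later[of "Suc k"] step by simp
    also have "\<dots> \<le> h * C * (3 / 4)"
      using hC step by (intro mult_left_mono) (auto simp: field_simps)
    finally have "S (Suc k) \<le> h * C * (3 / 4 * real k + 1 / 4) + h * C * (3 / 4)"
      using step.IH step S_Suc[of k] by linarith
    also have "\<dots> = h * C * (3 / 4 * real (Suc k) + 1 / 4)"
      by (simp add: field_simps)
    finally show ?case .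
  qed
  consider "k = 2" | "k = 3" | "4 \<le> k"
    using \<open>2 \<le> k\<close> by linarith
  then show ?thesis
  proof cases
    case 1
    with S2 hC show ?thesis by (simp add: S_def)
  next
    case 2
    with S3 hC \<open>k \<le> M\<close> show ?thesis by (simp add: S_def)
  next
    case 3
    with S \<open>k \<le> M\<close> show ?thesis by (simp add: S_def)
  qed
qed

text \<open>The projection solves the prox subproblem exactly; its variational inequality is the gap
  inequality with accuracy 0.\<close>

lemma closest_point_prox_gap:
  fixes P :: "'a::euclidean_space set"
  assumes "convex P" "closed P" "v \<in> P" "w = closest_point P (y - \<eta> *\<^sub>R g)"
  shows "\<eta> * (g \<bullet> (w - v)) + (w - y) \<bullet> (w - v) \<le> 0"
  using closest_point_dot[OF assms(1-3), of "y - \<eta> *\<^sub>R g"] assms(4)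
  by (simp add: inner_diff_left inner_diff_right right_diff_distrib)

text \<open>Stated for arbitrary sequences satisfying the gap inequalities, so that the last step
  may be an exact prox step instead of a call of the procedure. The recursion for \<open>x\<close>
  is required only below \<open>M\<close>.\<close>

lemma adcgs_potential:
  fixes x y z :: "nat \<Rightarrow> 'a::real_inner"
  assumes f: "convex_on UNIV f" and D: "\<And>w. GDERIV f w :> g w"
    and u: "u \<in> P" and z_in: "\<And>k. 1 \<le> k \<Longrightarrow> k \<le> M \<Longrightarrow> z k \<in> P"
    and fu: "\<And>k. 1 \<le> k \<Longrightarrow> k < M \<Longrightarrow> f u \<le> f (x k)"
    and gap: "\<And>k v. 1 \<le> k \<Longrightarrow> k \<le> M \<Longrightarrow> v \<in> P \<Longrightarrow>
      \<eta> k * (g (x (k - 1)) \<bullet> (z k - v)) + (z k - y (k - 1)) \<bullet> (z k - v) \<le> \<eta> k * \<epsilon> k"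
    and y: "y 1 = y 0" "\<And>k. 2 \<le> k \<Longrightarrow> k \<le> M \<Longrightarrow> y k = (1 - \<beta>) *\<^sub>R y (k - 1) + \<beta> *\<^sub>R z k"
    and x: "x 0 = y 0" "x 1 = z 1"
      "\<And>k. 2 \<le> k \<Longrightarrow> k < M \<Longrightarrow> (1 + \<tau> k) *\<^sub>R x k = \<tau> k *\<^sub>R x (k - 1) + z k"
    and \<tau>: "\<tau> 1 = 0"
    and \<beta>: "0 < \<beta>" "\<beta> < 1"
    and \<eta>_pos: "\<And>k. 1 \<le> k \<Longrightarrow> k \<le> M \<Longrightarrow> 0 < \<eta> k"
    and \<eta>2: "\<eta> 2 \<le> (1 - \<beta>) * \<eta> 1" "4 * L 1 * \<eta> 2 \<le> 1"
    and \<eta>: "\<And>k. 3 \<le> k \<Longrightarrow> k \<le> M \<Longrightarrow> \<eta> k \<le> 2 * (1 - \<beta>)\<^sup>2 * \<eta> (k - 1)"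
      "\<And>k. 3 \<le> k \<Longrightarrow> k \<le> M \<Longrightarrow> \<eta> k * \<tau> (k - 1) \<le> \<eta> (k - 1) * (1 + \<tau> (k - 2))"
      "\<And>k. 3 \<le> k \<Longrightarrow> k \<le> M \<Longrightarrow> 4 * L (k - 1) * \<eta> k \<le> \<tau> (k - 1)"
    and L1: "0 \<le> L 1" "norm (g (x 1) - g (x 0)) \<le> L 1 * norm (x 1 - x 0)"
    and L: "\<And>k. 2 \<le> k \<Longrightarrow> k < M \<Longrightarrow>
      (norm (g (x k) - g (x (k - 1))))\<^sup>2 \<le> 2 * L k * bregman f g (x (k - 1)) (x k)"
    and k: "2 \<le> k" "k \<le> M"
  shows "\<eta> k * ((1 + \<tau> (k - 1)) * (f (x (k - 1)) - f u)) + 1 / (2 * \<beta>) * (norm (y k - u))\<^sup>2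
      + (norm (z k - y (k - 1)))\<^sup>2 / 4
    \<le> 1 / (2 * \<beta>) * (norm (y 0 - u))\<^sup>2
      + \<eta> 2 / 2 * (5 * L 1 / 2 - 1 / \<eta> 1) * (norm (z 1 - y 0))\<^sup>2
      + (\<Sum>j=2..k. \<eta> j * (\<epsilon> j + \<epsilon> (j - 1)))"
    (is "?\<Phi> k \<le> ?E + ?S k")
  using k
proof (induction k rule: dec_induct)
  case base
  have "\<eta> 2 * (g (x 1) \<bullet> (z 2 - u)) + (z 2 - y 0) \<bullet> (z 2 - u) \<le> \<eta> 2 * \<epsilon> 2"
    using gap[of 2 u] base u y by simp
  moreover have "\<eta> 1 * (g (x 0) \<bullet> (z 1 - z 2)) + (z 1 - y 0) \<bullet> (z 1 - z 2) \<le> \<eta> 1 * \<epsilon> 1"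
    using gap[of 1 "z 2"] base z_in by simp
  ultimately have "\<eta> 2 * (g (x 1) \<bullet> (z 1 - u))
      + 1 / (2 * \<beta>) * (norm ((1 - \<beta>) *\<^sub>R y 0 + \<beta> *\<^sub>R z 2 - u))\<^sup>2 + (norm (z 2 - y 0))\<^sup>2 / 4
    \<le> ?E + \<eta> 2 * (\<epsilon> 2 + \<epsilon> 1)"
    using base x \<beta> \<eta>_pos \<eta>2 L1 by (intro first_averaged_step) auto
  moreover have "\<eta> 2 * (f (x 1) - f u) \<le> \<eta> 2 * (g (x 1) \<bullet> (z 1 - u))"
    using extrapolated_gradient_inequality[where g=g, OF f D, where \<tau>=0 and w="x 1" and w'="x 0" and z="z 1" and u=u] x base \<eta>_pos[of 2]
    by (intro mult_left_mono) auto
  ultimately show ?case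
    using y(1) y(2)[of 2] base \<tau> by simp
next
  case (step k)
  let ?a = "g (x k)" and ?b = "g (x (k - 1))" and ?\<eta> = "\<eta> (Suc k)"
    and ?B = "bregman f g (x (k - 1)) (x k)"
  have \<eta>_k: "0 < ?\<eta>" "0 < \<eta> k"
    using \<eta>_pos step by simp_all
  have "?\<eta> * (?a \<bullet> (z (Suc k) - u)) + (z (Suc k) - y k) \<bullet> (z (Suc k) - u) \<le> ?\<eta> * \<epsilon> (Suc k)"
    using gap[of "Suc k" u] step u by simp
  moreover have "\<eta> k * (?b \<bullet> (z k - z (Suc k))) + (z k - y (k - 1)) \<bullet> (z k - z (Suc k)) \<le> \<eta> k * \<epsilon> k"
    using gap[of k "z (Suc k)"] step z_in by simp
  moreover have "y k = (1 - \<beta>) *\<^sub>R y (k - 1) + \<beta> *\<^sub>R z k"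
    using y(2)[of k] step by simp
  moreover have "?\<eta> \<le> 2 * (1 - \<beta>)\<^sup>2 * \<eta> k"
    using \<eta>(1)[of "Suc k"] step by simp
  moreover have y_Suc: "y (Suc k) = (1 - \<beta>) *\<^sub>R y k + \<beta> *\<^sub>R z (Suc k)"
    using y(2)[of "Suc k"] step by simp
  ultimately have "?\<eta> * (?a \<bullet> (z k - u)) + 1 / (2 * \<beta>) * (norm (y (Suc k) - u))\<^sup>2
      + (norm (z (Suc k) - y k))\<^sup>2 / 4
    \<le> 1 / (2 * \<beta>) * (norm (y k - u))\<^sup>2 + (norm (z k - y (k - 1)))\<^sup>2 / 4
      + 2 * ?\<eta>\<^sup>2 * (norm (?a - ?b))\<^sup>2 + ?\<eta> * (\<epsilon> (Suc k) + \<epsilon> k)"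
    using \<eta>_k \<beta> unfolding y_Suc by (intro averaged_step) auto
  \<comment> \<open>The local estimate converts the gradient difference into a Bregman distance, and
    \<open>4 * L k * ?\<eta> \<le> \<tau> k\<close> makes it no larger than the surplus of the
    extrapolation.\<close>
  moreover have "2 * ?\<eta>\<^sup>2 * (norm (?a - ?b))\<^sup>2 \<le> ?\<eta> * (\<tau> k * ?B)"
  proof -
    have "2 * ?\<eta>\<^sup>2 * (norm (?a - ?b))\<^sup>2 \<le> 2 * ?\<eta>\<^sup>2 * (2 * L k * ?B)"
      using L[of k] step by (intro mult_left_mono) auto
    also have "\<dots> = ?\<eta> * ((4 * L k * ?\<eta>) * ?B)"
      by (simp add: power2_eq_square)
    also have "\<dots> \<le> ?\<eta> * (\<tau> k * ?B)"
      using \<eta>(3)[of "Suc k"] step \<eta>_k bregman_nonneg[OF f D]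
      by (intro mult_left_mono mult_right_mono) auto
    finally show ?thesis .
  qed
  moreover have "?\<eta> * ((1 + \<tau> k) * (f (x k) - f u) + \<tau> k * ?B)
      \<le> ?\<eta> * (?a \<bullet> (z k - u) + \<tau> k * (f (x (k - 1)) - f u))"
    using extrapolated_gradient_inequality[where g=g, OF f D, where \<tau>="\<tau> k" and w="x k" and w'="x (k - 1)" and z="z k" and u=u] x(3)[of k]
      step \<eta>_k by (intro mult_left_mono) auto
  \<comment> \<open>The weight condition makes the function values telescope; multiplying by the gap
    \<open>f (x (k - 1)) - f u\<close> uses that it is nonnegative.\<close>
  moreover have "?\<eta> * (\<tau> k * (f (x (k - 1)) - f u)) \<le> \<eta> k * ((1 + \<tau> (k - 1)) * (f (x (k - 1)) - f u))"
    unfolding mult.assoc[symmetric]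
    using \<eta>(2)[of "Suc k"] fu[of "k - 1"] step by (intro mult_right_mono) (auto simp: numeral_2_eq_2)
  moreover have "?S (Suc k) = ?S k + ?\<eta> * (\<epsilon> (Suc k) + \<epsilon> k)"
    using step by simp
  moreover have "?\<Phi> k \<le> ?E + ?S k"
    using step by simp
  ultimately show ?case
    unfolding diff_Suc_1 distrib_left[of ?\<eta> _ "\<tau> k * _"] by argo
qed

theorem corollary3p5:
  fixes f :: "real ^ 'n \<Rightarrow> real"
    and g :: "real ^ 'n \<Rightarrow> real ^ 'n"
    and P :: "(real ^ 'n) set"
    and xs :: "real ^ 'n"
    and x y z :: "nat \<Rightarrow> real ^ 'n"
    and N :: nat
    and \<beta> D\<^sub>0 E Lhat :: real
    and \<beta>s \<delta> \<eta> \<tau> L :: "nat \<Rightarrow> real"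
  assumes gradient: "\<And>w. GDERIV f w :> g w"
    and C1: "continuous_on UNIV g"
    and convex_f: "convex_on UNIV f"
    and P: "P \<noteq> {}" "compact P" "convex P"
    and minimizer: "is_arg_min f (\<lambda>w. w \<in> P) xs"
    and N: "N \<ge> 1"
    and D0: "D\<^sub>0 = norm (z 0 - xs)"
    and delta: "\<And>k. k \<ge> 1 \<Longrightarrow> \<delta> k = D\<^sub>0\<^sup>2 / (real N * real k)"
    and tau: "\<tau> 1 = 0" "\<And>k. k \<ge> 2 \<Longrightarrow> \<tau> k = real k / 2"
    and beta: "0 < \<beta>" "\<beta> \<le> 1 - sqrt 6 / 3"
    and betas: "\<beta>s 1 = 0" "\<And>k. k \<ge> 2 \<Longrightarrow> \<beta>s k = \<beta>"
    and run: "adcgs P g \<beta>s \<delta> \<eta> \<tau> N x y z"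
    and x1: "x 1 \<noteq> x 0"
    and L: "\<And>k. k \<ge> 1 \<Longrightarrow> L k = lip_est f g x k"
    \<comment> \<open>In \<open>ereal\<close>, as in the convention used here, a positive number divided by 0 is \<open>\<infinity>\<close>.
      The last stepsize computed by \<open>N\<close> iterations is \<open>\<eta> (N + 1)\<close>.\<close>
    and eta1: "\<eta> 1 > 0"
    and eta2: "ereal (\<eta> 2) = min (ereal ((1 - \<beta>) * \<eta> 1)) (1 / ereal (4 * L 1))"
    and eta3: "N \<ge> 2 \<Longrightarrow> ereal (\<eta> 3) = min (ereal (\<eta> 2)) (1 / ereal (4 * L 2))"
    and eta: "\<And>k. 4 \<le> k \<Longrightarrow> k \<le> N + 1 \<Longrightarrow>
        ereal (\<eta> k) = min (ereal (real k / (real k - 1) * \<eta> (k - 1)))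
                          (ereal (real k - 1) / ereal (8 * L (k - 1)))"
    and Lhat: "Lhat = max (1 / (4 * (1 - \<beta>) * \<eta> 1)) (MAX i\<in>{1..N}. L i)"
    and E: "E = 1 / (2 * \<beta>) * (norm (z 0 - xs))\<^sup>2
              + \<eta> 2 / 2 * (5 * L 1 / 2 - 1 / \<eta> 1) * (norm (z 1 - z 0))\<^sup>2"
  shows "f (x N) - f xs
     \<le> 12 * Lhat / (real N * (real N + 1)) * (2 * E + 3 * (1 - \<beta>) * \<eta> 1 * D\<^sub>0\<^sup>2 / 2)"
proof -

  \<comment> \<open>Constants and the range of \<open>\<beta>\<close>\<close>
  define M s h where "M = N + 1" and "s = 1 - \<beta>" and "h = s * \<eta> 1"
  have "2 \<le> M" using N by (simp add: M_def)
  have "12 / 5 < sqrt 6" by (rule real_less_rsqrt) (simp add: power2_eq_square)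
  then have s: "4 / 5 < s" "s < 1" "\<beta> < 1 / 5" "\<beta> < 1"
    using beta by (auto simp: s_def)
  \<comment> \<open>The source of the bound on \<open>\<beta>\<close>: it gives
    \<open>2 * s\<^sup>2 \<ge> 4 / 3\<close>, and \<open>4 / 3\<close> is the largest growth factor
    \<open>k / (k - 1)\<close> of the stepsizes, attained at \<open>k = 4\<close>.\<close>
  have "sqrt 6 / 3 \<le> s" using beta by (simp add: s_def)
  then have "(sqrt 6 / 3)\<^sup>2 \<le> s\<^sup>2" by (intro power_mono) auto
  then have s_sq: "2 / 3 \<le> s\<^sup>2" by (simp add: power_divide)
  have h: "0 < h" using s eta1 by (simp add: h_def)

  \<comment> \<open>Feasibility of the iterates\<close>
  have run0: "x 0 \<in> P" "y 0 = x 0" "z 0 = x 0"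
    using run by (auto simp: adcgs_def)
  have runk: "0 \<le> \<beta>s k" "\<beta>s k \<le> 1" "0 < \<delta> k" "0 < \<eta> k" "0 \<le> \<tau> k"
      "CG P (g (x (k - 1))) (y (k - 1)) (\<eta> k) (\<delta> k) (z k)"
      "y k = (1 - \<beta>s k) *\<^sub>R y (k - 1) + \<beta>s k *\<^sub>R z k"
      "x k = (\<tau> k / (1 + \<tau> k)) *\<^sub>R x (k - 1) + (1 / (1 + \<tau> k)) *\<^sub>R z k"
    if "1 \<le> k" "k \<le> N" for k
    using run that by (auto simp: adcgs_def)
  have in_P: "x k \<in> P \<and> y k \<in> P \<and> (1 \<le> k \<longrightarrow> z k \<in> P)" if "k \<le> N" for k
    using that
  proof (induction k)
    case 0
    then show ?case using run0 by simp
  next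
    case (Suc k)
    note r = runk[of "Suc k", simplified]
    have z: "z (Suc k) \<in> P"
      using r Suc CG_in[OF _ P(2,3)] by simp
    moreover have "y (Suc k) \<in> P"
      using r Suc z convexD[OF P(3), of "y k" "z (Suc k)" "1 - \<beta>s (Suc k)" "\<beta>s (Suc k)"] by simp
    moreover have "x (Suc k) \<in> P"
      using r Suc z convexD[OF P(3), of "x k" "z (Suc k)" "\<tau> (Suc k) / (1 + \<tau> (Suc k))" "1 / (1 + \<tau> (Suc k))"]
      by (simp add: add_divide_distrib[symmetric])
    ultimately show ?case by simp
  qed
  have xs: "xs \<in> P" "\<And>w. w \<in> P \<Longrightarrow> f xs \<le> f w"
    using minimizer by (auto simp: is_arg_min_linorder)
  have L_nonneg: "0 \<le> L k" if "1 \<le> k" for k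
    using L[OF that] lip_est_nonneg[OF convex_f gradient] by simp

  \<comment> \<open>Two-sided stepsize bounds\<close>
  have eta2': "ereal (\<eta> 2) = min (ereal h) (ereal 1 / ereal (4 * L 1))"
    using eta2 by (simp add: h_def s_def one_ereal_def)
  have eta2_le: "\<eta> 2 \<le> h" "4 * L 1 * \<eta> 2 \<le> 1"
    and eta2_cases: "\<eta> 2 = h \<or> 0 < 4 * L 1 \<and> \<eta> 2 = 1 / (4 * L 1)"
    using ereal_eq_min_divide[OF eta2'] L_nonneg[of 1] by (simp_all add: mult.commute)
  have eta3': "ereal (\<eta> 3) = min (ereal (\<eta> 2)) (ereal 1 / ereal (4 * L 2))" if "2 \<le> N"
    using eta3 that by (simp add: one_ereal_def)
  have eta3_le: "\<eta> 3 \<le> \<eta> 2" "4 * L 2 * \<eta> 3 \<le> 1"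
    and eta3_cases: "\<eta> 3 = \<eta> 2 \<or> 0 < 4 * L 2 \<and> \<eta> 3 = 1 / (4 * L 2)" if "2 \<le> N"
    using ereal_eq_min_divide[OF eta3'[OF that]] L_nonneg[of 2] by (simp_all add: mult.commute)
  have etak_le: "\<eta> k \<le> real k / (real k - 1) * \<eta> (k - 1)"
      "\<eta> k * (8 * L (k - 1)) \<le> real k - 1"
    and etak_cases: "\<eta> k = real k / (real k - 1) * \<eta> (k - 1)
      \<or> 0 < 8 * L (k - 1) \<and> \<eta> k = (real k - 1) / (8 * L (k - 1))"
    if "4 \<le> k" "k \<le> M" for k
    using ereal_eq_min_divide[OF eta[of k]] that L_nonneg[of "k - 1"] by (auto simp: M_def)

  have Lhat_ge: "1 / (4 * h) \<le> Lhat" "\<And>i. 1 \<le> i \<Longrightarrow> i \<le> N \<Longrightarrow> L i \<le> Lhat"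
    unfolding Lhat h_def s_def mult.assoc by (rule max.cobounded1) (auto intro!: max.coboundedI2 Max_ge)
  have "0 < 1 / (4 * h)" using h by simp
  then have Lhat_pos: "0 < Lhat" using Lhat_ge(1) by linarith
  \<comment> \<open>The first entry of \<open>Lhat\<close> covers the case
    \<open>\<eta> 2 = h\<close>, the entry \<open>L 1\<close> the other one.\<close>
  have eta2_ge: "1 / (4 * Lhat) \<le> \<eta> 2"
    using eta2_cases
  proof
    assume "\<eta> 2 = h"
    then show ?thesis using Lhat_ge(1) Lhat_pos h by (simp add: field_simps)
  next
    assume "0 < 4 * L 1 \<and> \<eta> 2 = 1 / (4 * L 1)"
    then show ?thesis using Lhat_ge(2)[of 1] N Lhat_pos by (auto intro!: divide_left_mono)
  qed
  have eta3_ge: "1 / (4 * Lhat) \<le> \<eta> 3" if "2 \<le> N"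
    using eta3_cases[OF that]
  proof
    assume "\<eta> 3 = \<eta> 2"
    then show ?thesis using eta2_ge by simp
  next
    assume "0 < 4 * L 2 \<and> \<eta> 3 = 1 / (4 * L 2)"
    then show ?thesis using Lhat_ge(2)[of 2] that Lhat_pos by (auto intro!: divide_left_mono)
  qed
  have eta_ge: "real k / (12 * Lhat) \<le> \<eta> k" if "3 \<le> k" "k \<le> M" for k
    using stepsize_lower[of Lhat M L \<eta> k] that Lhat_pos Lhat_ge(2) eta3_ge etak_cases
    by (auto simp: M_def)
  have eta_le: "\<eta> k \<le> real k / 3 * h" if "3 \<le> k" "k \<le> M" for k
    using stepsize_upper[of \<eta> h M k] that eta2_le(1) eta3_le(1) etak_le(1) by (force simp: M_def)
  \<comment> \<open>The run guarantees positive stepsizes only up to \<open>N\<close>; at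
    \<open>M = N + 1\<close> positivity comes from the lower bounds.\<close>
  have eta_pos: "0 < \<eta> k" if "1 \<le> k" "k \<le> M" for k
  proof (cases "k \<le> N")
    case True
    then show ?thesis using runk(4) that by simp
  next
    case False
    then have k: "k = M" using that by (simp add: M_def)
    show ?thesis
    proof (cases "3 \<le> M")
      case True
      have "0 < real M / (12 * Lhat)" using Lhat_pos \<open>2 \<le> M\<close> by simp
      then show ?thesis using eta_ge[OF True] k by simp
    next
      case False
      then have "k = 2" using k \<open>2 \<le> M\<close> by simp
      moreover have "0 < 1 / (4 * Lhat)" using Lhat_pos by simp
      ultimately show ?thesis using eta2_ge by (metis less_le_trans)
    qed
  qed

  \<comment> \<open>The bound for \<open>x N\<close> comes from step \<open>N + 1\<close>, whose \<open>z\<close>-iterate the run does not compute: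
    the exact prox point, with accuracy 0, takes its place.\<close>
  define z' y' \<epsilon> where "z' = z(M := closest_point P (y N - \<eta> M *\<^sub>R g (x N)))"
    and "y' = y(M := (1 - \<beta>) *\<^sub>R y N + \<beta> *\<^sub>R z' M)"
    and "\<epsilon> = \<delta>(M := 0)"
  have low: "z' k = z k" "y' k = y k" "\<epsilon> k = \<delta> k" if "k \<le> N" for k
    using that by (auto simp: z'_def y'_def \<epsilon>_def M_def)
  have z'M: "z' M = closest_point P (y N - \<eta> M *\<^sub>R g (x N))" and "\<epsilon> M = 0"
    by (simp_all add: z'_def \<epsilon>_def)
  have "closed P" using P(2) by (rule compact_imp_closed)
  have z'_in: "z' k \<in> P" if "1 \<le> k" "k \<le> M" for k
    using that in_P low closest_point_in_set[OF \<open>closed P\<close> P(1)] z'M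
    by (cases "k = M") (auto simp: M_def)
  have gap: "\<eta> k * (g (x (k - 1)) \<bullet> (z' k - v)) + (z' k - y' (k - 1)) \<bullet> (z' k - v) \<le> \<eta> k * \<epsilon> k"
    if "1 \<le> k" "k \<le> M" "v \<in> P" for k v
  proof (cases "k = M")
    case True
    then have "k - 1 = N" by (simp add: M_def)
    then show ?thesis
      using closest_point_prox_gap[OF P(3) \<open>closed P\<close> that(3) z'M] True low(2)[of N] \<open>\<epsilon> M = 0\<close> by simp
  next
    case False
    then have "k \<le> N" using that by (simp add: M_def)
    then show ?thesis
      using CG_gap[OF runk(6) P(2,3) runk(4), of k v] that in_P[of "k - 1"] low by simp
  qed
  have x1z: "x 1 = z 1" and y1: "y 1 = y 0"
    using runk(7,8)[of 1] N tau betas by simp_all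
  have y'_rec: "y' k = (1 - \<beta>) *\<^sub>R y' (k - 1) + \<beta> *\<^sub>R z' k" if "2 \<le> k" "k \<le> M" for k
  proof (cases "k = M")
    case True
    then show ?thesis using low(2)[of N] by (simp add: y'_def M_def)
  next
    case False
    then have "k \<le> N" using that by (simp add: M_def)
    then show ?thesis using runk(7)[of k] betas(2)[of k] low that by simp
  qed
  have x_rec: "(1 + \<tau> k) *\<^sub>R x k = \<tau> k *\<^sub>R x (k - 1) + z' k" if "2 \<le> k" "k < M" for k
  proof -
    have "k \<le> N" using that by (simp add: M_def)
    then show ?thesis
      using arg_cong[OF runk(8)[of k], of "\<lambda>v. (1 + \<tau> k) *\<^sub>R v"] that runk(5)[of k] low
      by (simp add: scaleR_add_right)
  qed

  \<comment> \<open>Stepsize conditions for the potential\<close>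
  have ratio: "\<eta> k \<le> 2 * s\<^sup>2 * \<eta> (k - 1)" if "3 \<le> k" "k \<le> M" for k
  proof -
    have pos: "0 < \<eta> (k - 1)"
      using that by (intro eta_pos) auto
    have "\<eta> k \<le> 4 / 3 * \<eta> (k - 1)"
    proof (cases "k = 3")
      case True
      then show ?thesis using eta3_le(1) eta_pos[of 2] that by (simp add: M_def)
    next
      case False
      then have k: "4 \<le> k" using that by simp
      have "\<eta> k \<le> real k / (real k - 1) * \<eta> (k - 1)" using etak_le(1) k that by simp
      also have "\<dots> \<le> 4 / 3 * \<eta> (k - 1)"
        using k pos by (intro mult_right_mono) (auto simp: field_simps)
      finally show ?thesis .
    qed
    also have "\<dots> \<le> 2 * s\<^sup>2 * \<eta> (k - 1)"
      using s_sq pos by (intro mult_right_mono) auto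
    finally show ?thesis .
  qed
  \<comment> \<open>The stepsize rule is these two conditions solved for \<open>\<eta> k\<close>:
    for \<open>k = 3\<close> with \<open>\<tau> 1 = 0\<close> and \<open>\<tau> 2 = 1\<close>, for
    \<open>k \<ge> 4\<close> with \<open>1 + \<tau> (k - 2) = k / 2\<close> and
    \<open>\<tau> (k - 1) = (k - 1) / 2\<close>.\<close>
  have weights: "\<eta> k * \<tau> (k - 1) \<le> \<eta> (k - 1) * (1 + \<tau> (k - 2))"
      "4 * L (k - 1) * \<eta> k \<le> \<tau> (k - 1)" if "3 \<le> k" "k \<le> M" for k
  proof -
    consider "k = 3" | "4 \<le> k" using \<open>3 \<le> k\<close> by linarith
    then have "\<eta> k * \<tau> (k - 1) \<le> \<eta> (k - 1) * (1 + \<tau> (k - 2)) \<and> 4 * L (k - 1) * \<eta> k \<le> \<tau> (k - 1)"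
    proof cases
      case 1
      then show ?thesis using eta3_le that tau(1) tau(2)[of 2] by (simp add: M_def)
    next
      case 2
      have \<tau>_eq: "\<tau> (k - 1) = (real k - 1) / 2" "\<tau> (k - 2) = (real k - 2) / 2"
        using 2 by (simp_all add: tau(2) of_nat_diff)
      have "\<eta> k * (real k - 1) \<le> real k * \<eta> (k - 1)"
        using 2 etak_le(1)[of k] that by (simp add: field_simps)
      then show ?thesis
        unfolding \<tau>_eq using 2 etak_le(2)[of k] that by (simp add: field_simps)
    qed
    then show "\<eta> k * \<tau> (k - 1) \<le> \<eta> (k - 1) * (1 + \<tau> (k - 2))" "4 * L (k - 1) * \<eta> k \<le> \<tau> (k - 1)"
      by auto
  qed
  have L1: "norm (g (x 1) - g (x 0)) \<le> L 1 * norm (x 1 - x 0)"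
    using L[of 1] x1 by (simp add: lip_est_def)

  \<comment> \<open>The potential at step \<open>N + 1\<close>\<close>
  define F where "F = f (x N) - f xs"
  have F: "0 \<le> F" using xs(2) in_P[of N] by (simp add: F_def)
  have "\<eta> M * ((1 + \<tau> (M - 1)) * (f (x (M - 1)) - f xs)) + 1 / (2 * \<beta>) * (norm (y' M - xs))\<^sup>2
      + (norm (z' M - y' (M - 1)))\<^sup>2 / 4
    \<le> 1 / (2 * \<beta>) * (norm (y' 0 - xs))\<^sup>2
      + \<eta> 2 / 2 * (5 * L 1 / 2 - 1 / \<eta> 1) * (norm (z' 1 - y' 0))\<^sup>2
      + (\<Sum>j=2..M. \<eta> j * (\<epsilon> j + \<epsilon> (j - 1)))"
  proof (rule adcgs_potential[where P=P and f=f and g=g and x=x and M=M])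
    show "f xs \<le> f (x k)" if "1 \<le> k" "k < M" for k
      using xs(2) in_P[of k] that by (simp add: M_def)
    show "(norm (g (x k) - g (x (k - 1))))\<^sup>2 \<le> 2 * L k * bregman f g (x (k - 1)) (x k)"
      if "2 \<le> k" "k < M" for k
      using gradient_diff_eq_lip_est_bregman[OF convex_f gradient, of k x] L[of k] that by simp
    show "\<eta> 2 \<le> (1 - \<beta>) * \<eta> 1" "\<And>k. 3 \<le> k \<Longrightarrow> k \<le> M \<Longrightarrow> \<eta> k \<le> 2 * (1 - \<beta>)\<^sup>2 * \<eta> (k - 1)"
      using eta2_le(1) ratio by (simp_all add: h_def s_def)
    show "y' 1 = y' 0" "x 0 = y' 0" "x 1 = z' 1"
      using low N y1 run0 x1z by simp_all
  qed (use convex_f gradient xs z'_in gap y'_rec x_rec tau(1) beta s eta_pos eta2_le weights L1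
        L_nonneg \<open>2 \<le> M\<close> in auto)
  moreover have "0 \<le> 1 / (2 * \<beta>) * (norm (y' M - xs))\<^sup>2 + (norm (z' M - y' (M - 1)))\<^sup>2 / 4"
    using beta by simp
  moreover have "1 / (2 * \<beta>) * (norm (y' 0 - xs))\<^sup>2
      + \<eta> 2 / 2 * (5 * L 1 / 2 - 1 / \<eta> 1) * (norm (z' 1 - y' 0))\<^sup>2 = E"
    using low N run0 by (simp add: E)
  moreover have "(\<Sum>j=2..M. \<eta> j * (\<epsilon> j + \<epsilon> (j - 1)))
      = (\<Sum>j=2..N. \<eta> j * (\<delta> j + \<delta> (j - 1))) + \<eta> M * \<delta> N"
    using N low(3) \<open>\<epsilon> M = 0\<close> by (auto simp: M_def intro!: sum.cong)
  ultimately have main: "\<eta> M * ((1 + \<tau> N) * F)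
      \<le> E + (\<Sum>j=2..N. \<eta> j * (\<delta> j + \<delta> (j - 1))) + \<eta> M * \<delta> N"
    by (simp add: F_def M_def)

  \<comment> \<open>Lower bound on \<open>E\<close>\<close>
  define H where "H = h * D\<^sub>0\<^sup>2"
  have H: "0 \<le> H" using h by (simp add: H_def)
  have E_ge: "- (5 / 4) * (H / real N) \<le> 2 * E"
  proof -
    let ?r = "norm (z 1 - z 0)" and ?a = "1 - 5 / 2 * (\<eta> 1 * L 1)"
    have E_eq: "2 * E = D\<^sub>0\<^sup>2 / \<beta> - \<eta> 2 / \<eta> 1 * (?a * ?r\<^sup>2)"
      using eta1 beta by (simp add: E D0 field_simps)
    have ratio1: "0 \<le> \<eta> 2 / \<eta> 1" "\<eta> 2 / \<eta> 1 \<le> s"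
      using eta2_le(1) eta1 eta_pos[of 2] \<open>2 \<le> M\<close> by (simp_all add: h_def field_simps)
    define R where "R = 5 / 4 * (\<eta> 1 * \<delta> 1) + 15 / 8 * D\<^sub>0\<^sup>2"
    have R: "0 \<le> R" using eta1 runk(3)[of 1] N by (simp add: R_def)
    have "?a * ?r\<^sup>2 \<le> R"
    proof (cases "5 * (\<eta> 1 * L 1) \<le> 2")
      case True
      have "\<eta> 1 * (g (x 0) \<bullet> (z 1 - xs)) + (z 1 - z 0) \<bullet> (z 1 - xs) \<le> \<eta> 1 * \<delta> 1"
        using gap[of 1 xs] xs(1) N low run0 by (simp add: M_def)
      moreover have "f (x 1) + g (x 1) \<bullet> (xs - x 1) \<le> f xs"
        by (rule convex_gderiv_above_tangent[OF convex_f gradient])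
      then have "0 \<le> g (x 1) \<bullet> (z 1 - xs)"
        using xs(2)[of "x 1"] in_P[of 1] N x1z by (simp add: inner_diff_right)
      moreover have "norm (g (x 1) - g (x 0)) \<le> L 1 * norm (z 1 - z 0)"
        using L1 x1z run0 by simp
      ultimately show ?thesis
        unfolding R_def D0 using L_nonneg[of 1] eta1 True by (intro first_step_length) auto
    next
      case False
      then have "?a * ?r\<^sup>2 \<le> 0" by (intro mult_nonpos_nonneg) auto
      then show ?thesis using R by linarith
    qed
    then have "\<eta> 2 / \<eta> 1 * (?a * ?r\<^sup>2) \<le> \<eta> 2 / \<eta> 1 * R"
      using ratio1 by (intro mult_left_mono)
    also have "\<dots> \<le> s * R"
      using ratio1 R by (intro mult_right_mono)
    also have "\<dots> = 5 / 4 * (H / real N) + 15 / 8 * s * D\<^sub>0\<^sup>2"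
      using delta[of 1] by (simp add: R_def H_def h_def algebra_simps)
    \<comment> \<open>As \<open>\<beta> < 1 / 5\<close>, the distance term of \<open>E\<close>
      absorbs this part; only the contribution of \<open>\<delta> 1\<close>, which is
      \<open>5 / 4 * (H / real N)\<close>, remains.\<close>
    also have "15 / 8 * s * D\<^sub>0\<^sup>2 \<le> 1 / \<beta> * D\<^sub>0\<^sup>2"
    proof (rule mult_right_mono)
      have "15 / 8 * s \<le> 5" using s by simp
      also have "5 \<le> 1 / \<beta>" using s beta by (simp add: field_simps)
      finally show "15 / 8 * s \<le> 1 / \<beta>" .
    qed simp
    finally show ?thesis unfolding E_eq by simp
  qed

  \<comment> \<open>From the potential to the rate\<close>
  have goal_eq: "3 * (1 - \<beta>) * \<eta> 1 * D\<^sub>0\<^sup>2 / 2 = 3 / 2 * H"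
    by (simp add: H_def h_def s_def)
  have "real N * (real N + 1) * F \<le> 12 * Lhat * (2 * E + 3 / 2 * H)"
  \<comment> \<open>For \<open>N = 1\<close> the last stepsize is \<open>\<eta> 2\<close>, with
    lower bound \<open>1 / (4 * Lhat)\<close>, and the weight is \<open>1 + \<tau> 1 = 1\<close>, so
    the general formulas do not apply.\<close>
  proof (cases "N = 1")
    case True
    have "\<eta> 2 * \<delta> 1 \<le> H"
      using eta2_le(1) delta[of 1] True by (simp add: H_def mult_right_mono)
    then have "\<eta> 2 * F \<le> E + H"
      using main True tau(1) by (simp add: M_def numeral_2_eq_2)
    moreover have "1 / (4 * Lhat) * F \<le> \<eta> 2 * F"
      using eta2_ge F by (intro mult_right_mono)
    ultimately have "1 / (4 * Lhat) * F \<le> E + H"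
      by (rule order_trans[rotated])
    then have "F \<le> 4 * Lhat * (E + H)"
      using Lhat_pos by (simp add: field_simps)
    then have "2 * F \<le> 4 * Lhat * (2 * (E + H))"
      by (simp add: algebra_simps)
    \<comment> \<open>The inner factors differ by \<open>4 * E + 5 / 2 * H\<close>, which is
      nonnegative exactly by \<open>E_ge\<close> at \<open>N = 1\<close>.\<close>
    also have "\<dots> \<le> 4 * Lhat * (3 * (2 * E + 3 / 2 * H))"
      using E_ge True Lhat_pos by (intro mult_left_mono) auto
    finally show ?thesis using True by (simp add: algebra_simps)
  next
    case False
    then have N2: "2 \<le> N" using N by simp
    have \<delta>_eq: "\<delta> k = (D\<^sub>0\<^sup>2 / real N) / real k" if "1 \<le> k" for k
      using delta[OF that] by simp
    have "(\<Sum>j=2..N. \<eta> j * (\<delta> j + \<delta> (j - 1))) \<le> h * (D\<^sub>0\<^sup>2 / real N) * (3 / 4 * real N + 1 / 4)"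
      using h N2 \<delta>_eq eta2_le(1) eta_le by (intro weighted_accuracy_sum[where M=N]) (auto simp: M_def)
    \<comment> \<open>The \<open>1 / 2\<close> bounds \<open>(N + 1) / (3 * N)\<close> for
      \<open>N \<ge> 2\<close>.\<close>
    moreover have "\<eta> M * \<delta> N \<le> h * (D\<^sub>0\<^sup>2 / real N) * (1 / 2)"
    proof -
      have "\<eta> M * \<delta> N \<le> real M / 3 * h * \<delta> N"
        using eta_le[of M] N2 runk(3)[of N] by (intro mult_right_mono) (auto simp: M_def)
      also have "\<dots> = h * (D\<^sub>0\<^sup>2 / real N) * (real M / (3 * real N))"
        using \<delta>_eq[of N] N2 by (simp add: mult_ac)
      also have "\<dots> \<le> h * (D\<^sub>0\<^sup>2 / real N) * (1 / 2)"
        using h N2 by (intro mult_left_mono) (auto simp: M_def field_simps)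
      finally show ?thesis .
    qed
    ultimately have "\<eta> M * ((1 + \<tau> N) * F) \<le> E + (H / real N) * (3 / 4 * real N + 3 / 4)"
      using main by (simp add: H_def algebra_simps)
    moreover have "real M / (12 * Lhat) * ((1 + \<tau> N) * F) \<le> \<eta> M * ((1 + \<tau> N) * F)"
      using eta_ge[of M] N2 F tau(2)[of N] by (intro mult_right_mono) (auto simp: M_def)
    ultimately have "real M / (12 * Lhat) * ((1 + \<tau> N) * F) \<le> E + (H / real N) * (3 / 4 * real N + 3 / 4)"
      by linarith
    then have bound: "(real N + 1) * ((real N + 2) * F)
        \<le> 12 * Lhat * (2 * (E + (H / real N) * (3 / 4 * real N + 3 / 4)))"
      using Lhat_pos N2 tau(2)[of N] by (simp add: M_def field_simps)
    have "real N * (2 * (E + (H / real N) * (3 / 4 * real N + 3 / 4)))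
        = real N * (2 * E) + H * (3 / 2 * real N + 3 / 2)"
      using N2 by (simp add: field_simps)
    \<comment> \<open>This inequality allows the factor \<open>N / (N + 2)\<close> to be replaced by
      1. The two sides differ by \<open>4 * E + 3 / 2 * H\<close>, and \<open>E_ge\<close> with
      \<open>N \<ge> 2\<close> makes this nonnegative.\<close>
    also have "\<dots> \<le> (real N + 2) * (2 * E + 3 / 2 * H)"
    proof -
      have "H / real N \<le> H / 2"
        using H N2 by (intro divide_left_mono) auto
      then have "- (3 / 2) * H \<le> 4 * E"
        using E_ge H by linarith
      moreover have "(real N + 2) * (2 * E + 3 / 2 * H) - (real N * (2 * E) + H * (3 / 2 * real N + 3 / 2))
          = 4 * E + 3 / 2 * H"
        by (simp add: field_simps)
      ultimately show ?thesis by linarith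
    qed
    finally have *: "real N * (2 * (E + (H / real N) * (3 / 4 * real N + 3 / 4)))
      \<le> (real N + 2) * (2 * E + 3 / 2 * H)" .
    have "(real N + 2) * (real N * (real N + 1) * F) = real N * ((real N + 1) * ((real N + 2) * F))"
      by simp
    also have "\<dots> \<le> real N * (12 * Lhat * (2 * (E + (H / real N) * (3 / 4 * real N + 3 / 4))))"
      using bound by (intro mult_left_mono) auto
    also have "\<dots> = 12 * Lhat * (real N * (2 * (E + (H / real N) * (3 / 4 * real N + 3 / 4))))"
      by simp
    also have "\<dots> \<le> 12 * Lhat * ((real N + 2) * (2 * E + 3 / 2 * H))"
      using * Lhat_pos by (intro mult_left_mono) auto
    also have "\<dots> = (real N + 2) * (12 * Lhat * (2 * E + 3 / 2 * H))"
      by simp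
    finally show ?thesis
      by (rule mult_left_le_imp_le) simp
  qed
  then have "F \<le> 12 * Lhat * (2 * E + 3 / 2 * H) / (real N * (real N + 1))"
    using N by (subst pos_le_divide_eq) (simp_all add: mult.commute)
  then show ?thesis
    unfolding F_def goal_eq by simp
qed

end
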